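(* Let $\mathcal{F}\subseteq\mathcal{P}(W)$ be an opinion set (of arbitrary cardinality) over a set $W$ of worlds, let $(\mathcal{F},\mathcal{A},\mu)$ be a finite measure space, and let $\mathscr{I}$ be an integral inaccuracy measure on $(\mathcal{F},\mathcal{A},\mu)$. Then for every $\mu$-credence function $c$, if $c$ is $\mu$-incoherent, then there is a $\mu$-coherent $\mu$-credence function $c'$ that strongly dominates $c$ relative to $\mathscr{I}$, i.e. $\mathscr{I}(c,w)>\mathscr{I}(c',w)$ for all $w\in W$.
   Context: $W$ is a nonempty set and $\mathcal{F}\subseteq\mathcal{P}(W)$. A credence function on $\mathcal{F}$ is any function $c:\mathcal{F}\to[0,1]$. An algebra over $W$ is a subset of $\mathcal{P}(W)$ containing $W$ and closed under binary unions and complements. A credence function is coherent if it extends to a finitely additive probability function (with value $1$ on $W$) on some algebra over $W$ containing $\mathcal{F}$. For $w\in W$, $v_w:\mathcal{F}\to\{0,1\}$ is given by $v_w(p)=1$ iff $w\in p$. Here $\mathcal{A}$ is a $\sigma$-algebra of subsets of $\mathcal{F}$ and $\mu$ is a countably additive measure on it. A $\mu$-credence function is an $\mathcal{A}$-measurable function $c:\mathcal{F}\to[0,\infty)$ with $\mu(\{p:c(p)\notin[0,1]\})=0$. A $\mu$-credence function $c$ is $\mu$-coherent if there is a coherent credence function $c'$ on $\mathcal{F}$ with $c=c'$ $\mu$-a.e.; it is $\mu$-incoherent if there is no such $c'$. An integral inaccuracy measure on $(\mathcal{F},\mathcal{A},\mu)$ is a map $\mathscr{I}$ assigning to each $\mu$-credence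 function $c$ and each $w\in W$ the value $$\mathscr{I}(c,w)=B_{\varphi,\mu}(v_w,c)=\int_{\mathcal{F}}\mathfrak{d}(v_w(p),c(p))\,\mu(dp)\in[0,\infty],$$ where $\mathfrak{d}(x,y)=\varphi(x)-\varphi(y)-\varphi'(y)(x-y)$ for a strictly convex differentiable function $\varphi$ on $(0,\infty)$, extended to $0$ by $\varphi(0)=\lim_{x\to0^+}\varphi(x)$ and $\varphi'(0)=\lim_{x\to0^+}\varphi'(x)$, such that $\mathfrak{d}$ is bounded on $[0,1]^2$ (so these limits are finite). It is part of the definition that each $v_w$ ($w\in W$) is a $\mu$-credence function, i.e. is $\mathcal{A}$-measurable. *)

theory Defs
  imports "HOL-Analysis.Analysis"
begin

text \<open>Credence functions are total functions on \<^typ>\<open>'w set\<close>; only their values on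
  the opinion set matter.\<close>

definition credence_function :: "'w set set \<Rightarrow> ('w set \<Rightarrow> real) \<Rightarrow> bool" where
  "credence_function F c \<longleftrightarrow> (\<forall>p\<in>F. 0 \<le> c p \<and> c p \<le> 1)"

definition finitely_additive_probability ::
    "'w set \<Rightarrow> 'w set set \<Rightarrow> ('w set \<Rightarrow> real) \<Rightarrow> bool" where
  "finitely_additive_probability W A P \<longleftrightarrow>
     algebra W A \<and> (\<forall>p\<in>A. 0 \<le> P p) \<and> additive A P \<and> P W = 1"

definition coherent :: "'w set \<Rightarrow> 'w set set \<Rightarrow> ('w set \<Rightarrow> real) \<Rightarrow> bool" where
  "coherent W F c \<longleftrightarrow> credence_function F c \<and>
     (\<exists>A P. F \<subseteq> A \<and> finitely_additive_probability W A P \<and> (\<forall>p\<in>F. P p = c p))"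

definition valuation :: "'w \<Rightarrow> 'w set \<Rightarrow> real" where
  "valuation w p = (if w \<in> p then 1 else 0)"

text \<open>In the following, the measure space \<open>M\<close> bundles the opinion set
  (\<open>space M\<close>), the \<open>\<sigma>\<close>-algebra (\<open>sets M\<close>) and the measure (\<open>emeasure M\<close>).\<close>

definition mu_credence_function :: "'w set measure \<Rightarrow> ('w set \<Rightarrow> real) \<Rightarrow> bool" where
  "mu_credence_function M c \<longleftrightarrow>
     c \<in> borel_measurable M \<and> (\<forall>p\<in>space M. 0 \<le> c p) \<and>
     emeasure M {p \<in> space M. c p \<notin> {0..1}} = 0"

text \<open>The coherent credence function \<open>c'\<close> need not be measurable; \<open>c = c'\<close> almost
  everywhere means that the exceptional set is contained in a null set of \<open>M\<close>.\<close>

definition mu_coherent :: "'w set \<Rightarrow> 'w set measure \<Rightarrow> ('w set \<Rightarrow> real) \<Rightarrow> bool" where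
  "mu_coherent W M c \<longleftrightarrow> (\<exists>c'. coherent W (space M) c' \<and> (AE p in M. c p = c' p))"

abbreviation mu_incoherent :: "'w set \<Rightarrow> 'w set measure \<Rightarrow> ('w set \<Rightarrow> real) \<Rightarrow> bool" where
  "mu_incoherent W M c \<equiv> \<not> mu_coherent W M c"

definition strictly_convex_on :: "real set \<Rightarrow> (real \<Rightarrow> real) \<Rightarrow> bool" where
  "strictly_convex_on S f \<longleftrightarrow> convex S \<and>
     (\<forall>x\<in>S. \<forall>y\<in>S. \<forall>t. x \<noteq> y \<and> 0 < t \<and> t < 1 \<longrightarrow>
        f ((1 - t) * x + t * y) < (1 - t) * f x + t * f y)"

definition bregman :: "(real \<Rightarrow> real) \<Rightarrow> (real \<Rightarrow> real) \<Rightarrow> real \<Rightarrow> real \<Rightarrow> real" where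
  "bregman \<phi> \<phi>' x y = \<phi> x - \<phi> y - \<phi>' y * (x - y)"

text \<open>The two limit conditions say that the values at \<open>0\<close> are the extensions of
  \<open>\<phi>\<close> and of its derivative \<open>\<phi>'\<close> from the positive half-line by right limits. These
  limits are required to be finite: otherwise the divergence would not be bounded on the
  unit square.\<close>

definition bregman_generator :: "(real \<Rightarrow> real) \<Rightarrow> (real \<Rightarrow> real) \<Rightarrow> bool" where
  "bregman_generator \<phi> \<phi>' \<longleftrightarrow>
     strictly_convex_on {0<..} \<phi> \<and>
     (\<forall>x>0. (\<phi> has_real_derivative \<phi>' x) (at x)) \<and>
     (\<phi> \<longlongrightarrow> \<phi> 0) (at_right 0) \<and>
     (\<phi>' \<longlongrightarrow> \<phi>' 0) (at_right 0) \<and>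
     bounded ((\<lambda>(x, y). bregman \<phi> \<phi>' x y) ` ({0..1} \<times> {0..1}))"

text \<open>The divergence is nonnegative on the nonnegative quadrant, so the truncation of
  negative values by \<^const>\<open>ennreal\<close> has no effect here.\<close>

definition integral_bregman ::
    "(real \<Rightarrow> real) \<Rightarrow> (real \<Rightarrow> real) \<Rightarrow> 'w set measure \<Rightarrow>
       ('w set \<Rightarrow> real) \<Rightarrow> ('w set \<Rightarrow> real) \<Rightarrow> ennreal" where
  "integral_bregman \<phi> \<phi>' M a b = (\<integral>\<^sup>+ p. ennreal (bregman \<phi> \<phi>' (a p) (b p)) \<partial>M)"

definition integral_inaccuracy_measure ::
    "'w set \<Rightarrow> 'w set measure \<Rightarrow> (('w set \<Rightarrow> real) \<Rightarrow> 'w \<Rightarrow> ennreal) \<Rightarrow> bool" where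
  "integral_inaccuracy_measure W M I \<longleftrightarrow>
     (\<forall>w\<in>W. mu_credence_function M (valuation w)) \<and>
     (\<exists>\<phi> \<phi>'. bregman_generator \<phi> \<phi>' \<and>
        (\<forall>c. mu_credence_function M c \<longrightarrow>
           (\<forall>w\<in>W. I c w = integral_bregman \<phi> \<phi>' M (valuation w) c)))"

definition strongly_dominates ::
    "'w set \<Rightarrow> (('w set \<Rightarrow> real) \<Rightarrow> 'w \<Rightarrow> ennreal) \<Rightarrow>
       ('w set \<Rightarrow> real) \<Rightarrow> ('w set \<Rightarrow> real) \<Rightarrow> bool" where
  "strongly_dominates W I c' c \<longleftrightarrow> (\<forall>w\<in>W. I c w > I c' w)"

end

theory Submission
  imports Defs
begin

text \<open>Let \<open>K\<close> be the convex set of measurable restrictions of finitely additive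
  probabilities on \<open>Pow W\<close>; it contains every \<^term>\<open>valuation w\<close>. The Bregman
  projection \<open>\<pi>\<close> of \<open>c\<close> onto \<open>K\<close> satisfies
  \<open>D(k,c) \<ge> D(k,\<pi>) + D(\<pi>,c)\<close> for all \<open>k\<close> in \<open>K\<close>, and taking valuations for
  \<open>k\<close> gives strong dominance as soon as \<open>D(\<pi>,c) > 0\<close>. The projection is an almost
  everywhere limit of members of \<open>K\<close>; a cluster point of these in the product topology is a
  finitely additive probability that agrees with \<open>\<pi>\<close> wherever they converge. Hence
  \<open>\<pi>\<close> is coherent almost everywhere, and therefore differs from the incoherent
  \<open>c\<close> on a set that is not null.\<close>

subsection \<open>Bregman generators\<close>

context
  fixes \<phi> \<phi>' :: "real \<Rightarrow> real"
  assumes gen: "bregman_generator \<phi> \<phi>'"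
begin

lemma generator_deriv: "x > 0 \<Longrightarrow> (\<phi> has_real_derivative \<phi>' x) (at x)"
  and generator_limit_0: "(\<phi> \<longlongrightarrow> \<phi> 0) (at_right 0)"
  and generator_deriv_limit_0: "(\<phi>' \<longlongrightarrow> \<phi>' 0) (at_right 0)"
  using gen unfolding bregman_generator_def by auto

lemma generator_strict:
  assumes "x > 0" "y > 0" "x \<noteq> y" "0 < t" "t < 1"
  shows "\<phi> ((1 - t) * x + t * y) < (1 - t) * \<phi> x + t * \<phi> y"
  using gen assms unfolding bregman_generator_def strictly_convex_on_def Ball_def greaterThan_iff
  by blast

lemma generator_convex: "convex_on {0<..} \<phi>"
proof (rule convex_onI)
  fix t x y :: real
  assume "0 < t" "t < 1" "x \<in> {0<..}" "y \<in> {0<..}"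
  then show "\<phi> ((1 - t) *\<^sub>R x + t *\<^sub>R y) \<le> (1 - t) * \<phi> x + t * \<phi> y"
    using generator_strict[of x y t] by (cases "x = y") (auto simp: algebra_simps)
qed auto

lemma generator_continuous: "continuous_on {0..} \<phi>"
  unfolding continuous_on_def
proof
  fix x :: real assume "x \<in> {0..}"
  then consider "x = 0" | "x > 0" by fastforce
  then show "(\<phi> \<longlongrightarrow> \<phi> x) (at x within {0..})"
  proof cases
    case 1
    then show ?thesis using generator_limit_0 by (simp add: at_within_Ici_at_right)
  next
    case 2
    then have "isCont \<phi> x" using generator_deriv DERIV_isCont by blast
    then show ?thesis by (simp add: isCont_def tendsto_within_subset[of _ _ _ UNIV])
  qed
qed

section \<open>Sign of the divergence and strict convexity up to the boundary point 0\<close>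

lemma bregman_nonneg_pos:
  assumes "x > 0" "y > 0"
  shows "bregman \<phi> \<phi>' x y \<ge> 0"
proof -
  have "\<phi> x - \<phi> y \<ge> \<phi>' y * (x - y)"
    by (rule convex_on_imp_above_tangent[OF generator_convex])
      (use assms generator_deriv in \<open>auto simp: interior_open intro: has_field_derivative_at_within\<close>)
  then show ?thesis by (simp add: bregman_def)
qed

text \<open>The tangent inequality reaches the boundary by two right limits: first \<open>x\<close>
  tends to 0 with \<open>y > 0\<close> fixed, then \<open>y\<close> tends to 0 with \<open>x\<close>
  fixed.\<close>

lemma bregman_nonneg:
  assumes "x \<ge> 0" "y \<ge> 0"
  shows "bregman \<phi> \<phi>' x y \<ge> 0"
proof -
  have *: "bregman \<phi> \<phi>' x y \<ge> 0" if "x \<ge> 0" "y > 0" for x y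
  proof (cases "x = 0")
    case True
    have "((\<lambda>u. bregman \<phi> \<phi>' u y) \<longlongrightarrow> bregman \<phi> \<phi>' 0 y) (at_right 0)"
      unfolding bregman_def by (intro tendsto_intros generator_limit_0)
    moreover have "\<forall>\<^sub>F u in at_right 0. bregman \<phi> \<phi>' u y \<ge> 0"
      using eventually_at_right_less[of "0::real"]
      by eventually_elim (use bregman_nonneg_pos that in auto)
    ultimately show ?thesis
      using True tendsto_lowerbound trivial_limit_at_right_real by blast
  qed (use that bregman_nonneg_pos in auto)
  show ?thesis
  proof (cases "y = 0")
    case True
    have "((\<lambda>u. bregman \<phi> \<phi>' x u) \<longlongrightarrow> bregman \<phi> \<phi>' x 0) (at_right 0)"
      unfolding bregman_def
      by (intro tendsto_intros generator_limit_0 generator_deriv_limit_0)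
    moreover have "\<forall>\<^sub>F u in at_right 0. bregman \<phi> \<phi>' x u \<ge> 0"
      using eventually_at_right_less[of "0::real"]
      by eventually_elim (use * assms in auto)
    ultimately show ?thesis
      using True tendsto_lowerbound trivial_limit_at_right_real by blast
  qed (use * assms in auto)
qed

text \<open>Strictness is assumed only on the open half-line and a limit at 0 keeps only the weak
  inequality; strictness at 0 is regained from interior points.\<close>

lemma generator_strict_midpoint:
  assumes "x \<ge> 0" "y \<ge> 0" "x \<noteq> y"
  shows "\<phi> ((x + y) / 2) < (\<phi> x + \<phi> y) / 2"
proof -
  have pos: "\<phi> ((x + y) / 2) < (\<phi> x + \<phi> y) / 2" if "x > 0" "y > 0" "x \<noteq> y" for x y
    using generator_strict[of x y "1/2"] that by (simp add: field_simps)
  \<comment> \<open>In the sum of the divergences of \<open>x\<close> and \<open>y\<close> from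
    their midpoint the tangent terms cancel.\<close>
  have weak: "\<phi> ((x + y) / 2) \<le> (\<phi> x + \<phi> y) / 2" if "x \<ge> 0" "y \<ge> 0" for x y
    using bregman_nonneg[of x "(x + y) / 2"] bregman_nonneg[of y "(x + y) / 2"] that
    by (simp add: bregman_def field_simps)
  \<comment> \<open>\<open>y/2\<close> is the midpoint of the interior points \<open>y/4\<close> and
    \<open>3*y/4\<close>, which are themselves the midpoints of 0, \<open>y/2\<close> and of
    \<open>y/2\<close>, \<open>y\<close>. Chaining the three inequalities bounds
    \<open>\<phi> (y/2)\<close> partly by itself, and that part is absorbed on the left.\<close>
  have zero: "\<phi> (y / 2) < (\<phi> 0 + \<phi> y) / 2" if "y > 0" for y
    using weak[of 0 "y/2"] pos[of "y/4" "3*y/4"] weak[of "y/2" y] that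
    by (simp add: field_simps)
  show ?thesis
    using assms pos[of x y] zero[of x] zero[of y] by (cases "x = 0"; cases "y = 0") (auto simp: add.commute)
qed

text \<open>At the midpoint of \<open>x\<close> and \<open>y\<close> the divergence from
  \<open>y\<close> is nonnegative, and by strict midpoint convexity it is less than half of the
  divergence at \<open>x\<close>.\<close>

lemma bregman_pos:
  assumes "x \<ge> 0" "y \<ge> 0" "x \<noteq> y"
  shows "bregman \<phi> \<phi>' x y > 0"
  using bregman_nonneg[of "(x + y) / 2" y] generator_strict_midpoint[OF assms] assms
  by (simp add: bregman_def field_simps)

text \<open>The derivative at a point is squeezed between difference quotients towards
  fixed points on either side, and these quotients depend continuously on the point.\<close>

lemma generator_deriv_continuous: "continuous_on {0..} \<phi>'"
  unfolding continuous_on_def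
proof
  fix x :: real assume "x \<in> {0..}"
  then consider "x = 0" | "x > 0" by fastforce
  then show "(\<phi>' \<longlongrightarrow> \<phi>' x) (at x within {0..})"
  proof cases
    case 1
    then show ?thesis using generator_deriv_limit_0 by (simp add: at_within_Ici_at_right)
  next
    case 2
    have slope: "((\<lambda>z. (\<phi> z - \<phi> x) / (z - x)) \<longlongrightarrow> \<phi>' x) (at x)"
      using generator_deriv[OF 2] by (simp add: has_field_derivative_iff)
    have quotient: "((\<lambda>y. (\<phi> z - \<phi> y) / (z - y)) \<longlongrightarrow> (\<phi> z - \<phi> x) / (z - x)) (at x)"
      if "z \<noteq> x" for z
      using that DERIV_isCont[OF generator_deriv[OF 2]]
      by (intro tendsto_intros) (auto simp: isCont_def)
    have near: "\<forall>\<^sub>F y in at x. y > 0"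
      using 2 eventually_at_in_open'[of "{0<..}" x] by auto
    have "(\<phi>' \<longlongrightarrow> \<phi>' x) (at x)"
    proof (rule order_tendstoI)
      fix a assume "a < \<phi>' x"
      then have "\<forall>\<^sub>F z in at_left x. a < (\<phi> z - \<phi> x) / (z - x)"
        using order_tendstoD(1)[OF tendsto_within_subset[OF slope, of "{..<x}"]] by auto
      moreover have "\<forall>\<^sub>F z in at_left x. z > 0 \<and> z < x"
        using eventually_at_left_real[OF 2] by auto
      ultimately have "\<forall>\<^sub>F z in at_left x. a < (\<phi> z - \<phi> x) / (z - x) \<and> z > 0 \<and> z < x"
        by eventually_elim auto
      then obtain z where z: "a < (\<phi> z - \<phi> x) / (z - x)" "z > 0" "z < x"
        using eventually_happens'[OF trivial_limit_at_left_real] by blast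
      have "\<forall>\<^sub>F y in at x. a < (\<phi> z - \<phi> y) / (z - y)"
        using order_tendstoD(1)[OF quotient] z by auto
      moreover have "\<forall>\<^sub>F y in at x. y > z"
        using z eventually_at_in_open'[of "{z<..}" x] by auto
      ultimately show "\<forall>\<^sub>F y in at x. a < \<phi>' y"
      proof eventually_elim
        case (elim y)
        \<comment> \<open>Since \<open>z < y\<close>, this says that the secant slope between
          \<open>z\<close> and \<open>y\<close> is at most the derivative at
          \<open>y\<close>.\<close>
        have "bregman \<phi> \<phi>' z y \<ge> 0" using bregman_nonneg z elim by auto
        then have "(\<phi> z - \<phi> y) / (z - y) \<le> \<phi>' y"
          using elim by (simp add: bregman_def neg_divide_le_eq)
        then show ?case using elim by simp
      qed
    next
      fix a assume "a > \<phi>' x"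
      then have "\<forall>\<^sub>F z in at_right x. a > (\<phi> z - \<phi> x) / (z - x)"
        using order_tendstoD(2)[OF tendsto_within_subset[OF slope, of "{x<..}"]] by auto
      moreover have "\<forall>\<^sub>F z in at_right x. z > x"
        by (rule eventually_at_right_less)
      ultimately have "\<forall>\<^sub>F z in at_right x. a > (\<phi> z - \<phi> x) / (z - x) \<and> z > x"
        by eventually_elim auto
      then obtain z where z: "a > (\<phi> z - \<phi> x) / (z - x)" "z > x"
        using eventually_happens'[OF trivial_limit_at_right_real] by blast
      have "\<forall>\<^sub>F y in at x. a > (\<phi> z - \<phi> y) / (z - y)"
        using order_tendstoD(2)[OF quotient] z by auto
      moreover have "\<forall>\<^sub>F y in at x. y < z"
        using z eventually_at_in_open'[of "{..<z}" x] by auto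
      ultimately show "\<forall>\<^sub>F y in at x. a > \<phi>' y"
        using near
      proof eventually_elim
        case (elim y)
        have "bregman \<phi> \<phi>' z y \<ge> 0" using bregman_nonneg z 2 elim by auto
        then have "(\<phi> z - \<phi> y) / (z - y) \<ge> \<phi>' y"
          using elim by (simp add: bregman_def pos_le_divide_eq)
        then show ?case using elim by simp
      qed
    qed
    then show ?thesis by (simp add: tendsto_within_subset[of _ _ _ UNIV])
  qed
qed

section \<open>Continuity and uniform convexity on the compact unit square\<close>

lemma continuous_on_bregman:
  "continuous_on ({0..1} \<times> {0..1}) (\<lambda>z. bregman \<phi> \<phi>' (fst z) (snd z))"
  unfolding bregman_def
  by (intro continuous_intros continuous_on_compose2[OF generator_continuous]
      continuous_on_compose2[OF generator_deriv_continuous]) auto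

text \<open>On pairs at distance at least \<open>\<epsilon>\<close> the gap has a positive minimum
  by compactness; closer pairs are covered by the summand \<open>\<epsilon>\<close>. This later
  turns near-minimality into closeness in mean.\<close>

lemma dist_le_midpoint_gap:
  assumes "\<epsilon> > 0"
  shows "\<exists>C>0. \<forall>x\<in>{0..1}. \<forall>y\<in>{0..1}.
    \<bar>x - y\<bar> \<le> \<epsilon> + C * ((\<phi> x + \<phi> y) / 2 - \<phi> ((x + y) / 2))"
proof -
  define gap where "gap = (\<lambda>(x, y). (\<phi> x + \<phi> y) / 2 - \<phi> ((x + y) / 2))"
  define S :: "(real \<times> real) set" where "S = ({0..1} \<times> {0..1}) \<inter> {z. \<epsilon> \<le> \<bar>fst z - snd z\<bar>}"
  have "closed {z :: real \<times> real. \<epsilon> \<le> \<bar>fst z - snd z\<bar>}"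
    by (intro closed_Collect_le continuous_intros)
  then have "compact S" unfolding S_def by (intro compact_Int_closed compact_Times) auto
  have "continuous_on S gap"
    unfolding gap_def case_prod_beta
    by (intro continuous_intros continuous_on_compose2[OF generator_continuous]) (auto simp: S_def)
  have pos: "gap z > 0" if "z \<in> S" for z
    using generator_strict_midpoint[of "fst z" "snd z"] that assms
    by (auto simp: S_def gap_def)
  obtain \<delta> where \<delta>: "\<delta> > 0" "\<And>z. z \<in> S \<Longrightarrow> \<delta> \<le> gap z"
  proof (cases "S = {}")
    case False
    then obtain z where "z \<in> S" "\<forall>y\<in>S. gap z \<le> gap y"
      using continuous_attains_inf[OF \<open>compact S\<close> _ \<open>continuous_on S gap\<close>] by blast
    with pos that show ?thesis by blast
  qed (use that[of 1] in auto)
  have "\<bar>x - y\<bar> \<le> \<epsilon> + 1 / \<delta> * gap (x, y)" if "x \<in> {0..1}" "y \<in> {0..1}" for x y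
  proof (cases "(x, y) \<in> S")
    case True
    have "\<bar>x - y\<bar> \<le> 1" using that by auto
    also have "1 \<le> 1 / \<delta> * gap (x, y)" using \<delta> True by (simp add: field_simps)
    finally show ?thesis using assms by simp
  next
    case False
    have "gap (x, y) \<ge> 0"
      using generator_strict_midpoint[of x y] that by (cases "x = y") (auto simp: gap_def)
    then have "1 / \<delta> * gap (x, y) \<ge> 0" using \<delta> by simp
    then show ?thesis using False that unfolding S_def by auto
  qed
  then show ?thesis using \<delta>(1) by (intro exI[of _ "1 / \<delta>"]) (auto simp: gap_def)
qed

end

subsection \<open>Bregman projection\<close>

lemma borel_measurable_compose_continuous_on:
  fixes X :: "'a \<Rightarrow> 'b::t2_space" and G :: "'b \<Rightarrow> real"
  assumes "X \<in> borel_measurable M" "\<And>p. p \<in> space M \<Longrightarrow> X p \<in> S"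
    and "compact S" "continuous_on S G"
  shows "(\<lambda>p. G (X p)) \<in> borel_measurable M"
proof -
  \<comment> \<open>\<open>G\<close> is continuous only on \<open>S\<close>, so \<open>X\<close> is
    regarded as a map into that subspace.\<close>
  have "X \<in> M \<rightarrow>\<^sub>M restrict_space borel S"
    using assms by (intro measurable_restrict_space2) auto
  from measurable_compose[OF this borel_measurable_continuous_on_restrict[OF assms(4)]]
  show ?thesis .
qed

context finite_measure
begin

lemma integrable_compose_continuous_on:
  fixes X :: "'a \<Rightarrow> 'b::t2_space" and G :: "'b \<Rightarrow> real"
  assumes "X \<in> borel_measurable M" "\<And>p. p \<in> space M \<Longrightarrow> X p \<in> S"
    and "compact S" "continuous_on S G"
  shows "integrable M (\<lambda>p. G (X p))"
proof -
  have "bounded (G ` S)"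
    using compact_continuous_image[OF assms(4,3)] by (rule compact_imp_bounded)
  then obtain B where "\<And>x. x \<in> S \<Longrightarrow> norm (G x) \<le> B"
    unfolding bounded_iff by blast
  then show ?thesis
    using borel_measurable_compose_continuous_on[OF assms] assms(2)
    by (intro integrable_const_bound[of _ B] AE_I2) auto
qed

text \<open>Dominated convergence with a constant bound: \<open>G\<close> is bounded on the compact
  \<open>S\<close> and the measure is finite. The space containing \<open>S\<close> is general so
  that pairs and quadruples of functions can be inserted.\<close>

lemma integral_compose_continuous_on_tendsto:
  fixes X :: "nat \<Rightarrow> 'a \<Rightarrow> 'b::t2_space" and G :: "'b \<Rightarrow> real"
  assumes "\<And>n. X n \<in> borel_measurable M" "\<And>n p. p \<in> space M \<Longrightarrow> X n p \<in> S"
    and "Y \<in> borel_measurable M" "\<And>p. p \<in> space M \<Longrightarrow> Y p \<in> S"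
    and "AE p in M. (\<lambda>n. X n p) \<longlonglongrightarrow> Y p"
    and "compact S" "continuous_on S G"
  shows "(\<lambda>n. \<integral>p. G (X n p) \<partial>M) \<longlonglongrightarrow> (\<integral>p. G (Y p) \<partial>M)"
proof -
  have "bounded (G ` S)"
    using compact_continuous_image[OF assms(7,6)] by (rule compact_imp_bounded)
  then obtain B where B: "\<And>x. x \<in> S \<Longrightarrow> norm (G x) \<le> B"
    unfolding bounded_iff by blast
  show ?thesis
  proof (rule integral_dominated_convergence[where w = "\<lambda>_. B"])
    show "AE p in M. (\<lambda>n. G (X n p)) \<longlonglongrightarrow> G (Y p)"
      using assms(5) AE_space
    proof eventually_elim
      case (elim p)
      then show ?case
        using assms(2,4) by (intro continuous_on_tendsto_compose[OF assms(7)]) auto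
    qed
  qed (use assms B in \<open>auto intro!: borel_measurable_compose_continuous_on[of _ M S G]\<close>)
qed

lemma integrable_bregman:
  assumes gen: "bregman_generator \<phi> \<phi>'"
    and "g \<in> borel_measurable M" "\<And>p. p \<in> space M \<Longrightarrow> g p \<in> {0..1}"
    and "h \<in> borel_measurable M" "\<And>p. p \<in> space M \<Longrightarrow> h p \<in> {0..1}"
  shows "integrable M (\<lambda>p. bregman \<phi> \<phi>' (g p) (h p))"
proof -
  have "integrable M (\<lambda>p. (\<lambda>z. bregman \<phi> \<phi>' (fst z) (snd z)) (g p, h p))"
    by (rule integrable_compose_continuous_on[OF _ _ _ continuous_on_bregman[OF gen]])
      (use assms(2-) in \<open>auto intro!: compact_Times\<close>)
  then show ?thesis by simp
qed

text \<open>The midpoint gap of \<open>\<phi>\<close> makes a minimising sequence Cauchy in mean, so a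
  subsequence converges almost everywhere; its limit satisfies the generalised Pythagorean
  inequality because moving from it towards a member \<open>k\<close> cannot decrease the divergence.\<close>

lemma bregman_projection:
  fixes K :: "('a \<Rightarrow> real) set"
  assumes gen: "bregman_generator \<phi> \<phi>'"
    and "K \<noteq> {}"
    and K_meas: "\<And>g. g \<in> K \<Longrightarrow> g \<in> borel_measurable M"
    and K_range: "\<And>g p. g \<in> K \<Longrightarrow> p \<in> space M \<Longrightarrow> g p \<in> {0..1}"
    and K_convex: "\<And>g h t. \<lbrakk>g \<in> K; h \<in> K; 0 \<le> t; t \<le> 1\<rbrakk> \<Longrightarrow>
      (\<lambda>p. (1 - t) * g p + t * h p) \<in> K"
    and c_meas: "c \<in> borel_measurable M"
    and c_range: "\<And>p. p \<in> space M \<Longrightarrow> c p \<in> {0..1}"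
  obtains g \<pi> where "\<And>n::nat. g n \<in> K" "\<pi> \<in> borel_measurable M"
    "\<And>p. \<pi> p \<in> {0..1}" "AE p in M. (\<lambda>n. g n p) \<longlonglongrightarrow> \<pi> p"
    "\<And>k. k \<in> K \<Longrightarrow>
      (\<integral>p. bregman \<phi> \<phi>' (k p) (\<pi> p) \<partial>M) + (\<integral>p. bregman \<phi> \<phi>' (\<pi> p) (c p) \<partial>M)
        \<le> (\<integral>p. bregman \<phi> \<phi>' (k p) (c p) \<partial>M)"
proof -
  let ?d = "bregman \<phi> \<phi>'"
  define Q :: "(real \<times> real) set" where "Q = {0..1} \<times> {0..1}"
  have Q: "compact Q" unfolding Q_def by (intro compact_Times) auto
  note cont = continuous_on_compose2[OF generator_continuous[OF gen]]
    continuous_on_compose2[OF generator_deriv_continuous[OF gen]]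
  note d_cont = continuous_on_bregman[OF gen, folded Q_def]
  note d_int = integrable_bregman[OF gen]
  note [measurable] = c_meas
  define J where "J g = (\<integral>p. ?d (g p) (c p) \<partial>M)" for g
  have J_lim: "(\<lambda>n. J (g n)) \<longlonglongrightarrow> J h"
    if "\<And>n. g n \<in> borel_measurable M" "\<And>n p. p \<in> space M \<Longrightarrow> g n p \<in> {0..1}"
      "h \<in> borel_measurable M" "\<And>p. p \<in> space M \<Longrightarrow> h p \<in> {0..1}"
      "AE p in M. (\<lambda>n. g n p) \<longlonglongrightarrow> h p" for g h
  proof -
    have "AE p in M. (\<lambda>n. (g n p, c p)) \<longlonglongrightarrow> (h p, c p)"
      using that(5) by eventually_elim (intro tendsto_intros)
    from integral_compose_continuous_on_tendsto[OF _ _ _ _ this Q d_cont] that(1-4) c_range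
    show ?thesis by (simp add: J_def Q_def)
  qed
  have J_nonneg: "J g \<ge> 0" if "g \<in> K" for g
    unfolding J_def
    by (intro integral_nonneg_AE AE_I2 bregman_nonneg[OF gen]) (use that K_range c_range in auto)
  define m where "m = Inf (J ` K)"
  have m_le: "m \<le> J g" if "g \<in> K" for g
    unfolding m_def using J_nonneg that by (intro cINF_lower bdd_belowI2[of _ 0]) auto
  have "\<exists>g\<in>K. J g < m + 1 / real (Suc n)" for n
    using cInf_lessD[of "J ` K" "m + 1 / real (Suc n)"] \<open>K \<noteq> {}\<close>
    by (auto simp: m_def)
  then obtain g where gK: "\<And>n. g n \<in> K" and gJ: "\<And>n. J (g n) < m + 1 / real (Suc n)"
    by metis
  have J_g: "(\<lambda>n. J (g n)) \<longlonglongrightarrow> m"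
  proof (rule tendsto_sandwich[where f = "\<lambda>_. m"])
    show "(\<lambda>n. m + 1 / real (Suc n)) \<longlonglongrightarrow> m"
      using tendsto_add[OF tendsto_const LIMSEQ_inverse_real_of_nat, of m]
      by (simp add: inverse_eq_divide)
  qed (use m_le gK less_imp_le[OF gJ] in \<open>auto intro!: always_eventually\<close>)
  have g_int: "integrable M (g n)" for n
    by (intro integrable_const_bound[of _ 1] AE_I2) (use K_meas[OF gK] K_range[OF gK] in auto)
  have "\<exists>N. \<forall>i\<ge>N. \<forall>j\<ge>N. (\<integral>p. norm (g i p - g j p) \<partial>M) < e" if e: "e > 0" for e
  proof -
    let ?\<mu> = "measure M (space M)"
    \<comment> \<open>Adding 1 to the total mass avoids division by zero and makes the bound below
      strict.\<close>
    define \<epsilon> where "\<epsilon> = e / 2 / (?\<mu> + 1)"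
    have \<mu>: "?\<mu> + 1 > 0" by (intro add_nonneg_pos) auto
    have "\<epsilon> > 0" unfolding \<epsilon>_def using that \<mu> by (intro divide_pos_pos) auto
    then have "\<epsilon> * ?\<mu> < \<epsilon> * (?\<mu> + 1)" by simp
    also have "\<dots> = e / 2" using \<mu> unfolding \<epsilon>_def by (metis less_irrefl nonzero_eq_divide_eq)
    finally have \<epsilon>: "\<epsilon> * ?\<mu> < e / 2" .
    obtain C where C: "C > 0" "\<And>x y. \<lbrakk>x \<in> {0..1}; y \<in> {0..1}\<rbrakk> \<Longrightarrow>
      \<bar>x - y\<bar> \<le> \<epsilon> + C * ((\<phi> x + \<phi> y) / 2 - \<phi> ((x + y) / 2))"
      using dist_le_midpoint_gap[OF gen \<open>\<epsilon> > 0\<close>] by metis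
    obtain N where N: "\<And>n. n \<ge> N \<Longrightarrow> J (g n) < m + e / (2 * C)"
      using order_tendstoD(2)[OF J_g, of "m + e / (2 * C)"] e C(1)
      by (auto simp: eventually_sequentially)
    have "(\<integral>p. norm (g i p - g j p) \<partial>M) < e" if ij: "i \<ge> N" "j \<ge> N" for i j
    proof -
      define h where "h = (\<lambda>p. (1 - 1/2) * g i p + 1/2 * g j p)"
      have hK: "h \<in> K" unfolding h_def by (intro K_convex gK) auto
      note ints = d_int[OF K_meas[OF gK] K_range[OF gK] c_meas c_range, of i]
        d_int[OF K_meas[OF gK] K_range[OF gK] c_meas c_range, of j]
        d_int[OF K_meas[OF hK] K_range[OF hK] c_meas c_range]
      let ?gap = "\<lambda>p. ?d (g i p) (c p) / 2 + ?d (g j p) (c p) / 2 - ?d (h p) (c p)"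
      have "(\<integral>p. norm (g i p - g j p) \<partial>M) \<le> (\<integral>p. \<epsilon> + C * ?gap p \<partial>M)"
      proof (intro integral_mono)
        show "integrable M (\<lambda>p. norm (g i p - g j p))"
          by (intro integrable_norm Bochner_Integration.integrable_diff g_int)
        show "integrable M (\<lambda>p. \<epsilon> + C * ?gap p)" using ints by auto
        fix p assume p: "p \<in> space M"
        \<comment> \<open>The terms affine in the first argument cancel at a midpoint, so the gap
          does not depend on \<open>c\<close>.\<close>
        have "?gap p = (\<phi> (g i p) + \<phi> (g j p)) / 2 - \<phi> ((g i p + g j p) / 2)"
          by (simp add: bregman_def h_def field_simps)
        then show "norm (g i p - g j p) \<le> \<epsilon> + C * ?gap p"
          using C(2)[OF K_range[OF gK p] K_range[OF gK p]] by simp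
      qed
      also have "\<dots> = \<epsilon> * measure M (space M) + C * (J (g i) / 2 + J (g j) / 2 - J h)"
        using ints by (simp add: J_def)
      \<comment> \<open>\<open>h\<close> belongs to \<open>K\<close>, so \<open>J h\<close> is at
        least \<open>m\<close>; the tolerance \<open>e / (2 * C)\<close> was chosen to cancel the
        factor \<open>C\<close>.\<close>
      also have "C * (J (g i) / 2 + J (g j) / 2 - J h) \<le> C * (e / (2 * C))"
        using N[OF ij(1)] N[OF ij(2)] m_le[OF hK] C(1) by (intro mult_left_mono) auto
      also have "\<dots> = e / 2" using C(1) by simp
      finally show ?thesis using \<epsilon> by simp
    qed
    then show ?thesis by blast
  qed
  with g_int obtain r where r: "strict_mono r" "AE p in M. Cauchy (\<lambda>n. g (r n) p)"
    using cauchy_L1_AE_cauchy_subseq[of M g] by metis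
  define G where "G n = g (r n)" for n
  have GK: "G n \<in> K" for n by (simp add: G_def gK)
  note [measurable] = K_meas[OF GK]
  \<comment> \<open>\<open>lim\<close> is unspecified where the sequence diverges. Clamping keeps
    \<open>\<pi>\<close> in the unit interval everywhere and changes nothing at points of
    \<open>space M\<close> where the sequence converges.\<close>
  define \<pi> where "\<pi> p = max 0 (min 1 (lim (\<lambda>n. G n p)))" for p
  have \<pi>_meas [measurable]: "\<pi> \<in> borel_measurable M" unfolding \<pi>_def by measurable
  have \<pi>_range: "\<pi> p \<in> {0..1}" for p by (simp add: \<pi>_def)
  have G_lim: "AE p in M. (\<lambda>n. G n p) \<longlonglongrightarrow> \<pi> p"
    using r(2) AE_space
  proof eventually_elim
    case (elim p)
    then obtain l where l: "(\<lambda>n. G n p) \<longlonglongrightarrow> l"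
      unfolding G_def using Cauchy_convergent_iff convergent_def by blast
    have "l \<in> {0..1}"
      using closed_sequentially[OF _ _ l, of "{0..1}"] K_range[OF GK] elim by auto
    then show ?case using l limI[OF l] by (simp add: \<pi>_def)
  qed
  have m_eq: "(\<lambda>n. J (G n)) \<longlonglongrightarrow> m"
    unfolding G_def using LIMSEQ_subseq_LIMSEQ[OF J_g r(1)] by (simp add: o_def)
  have J_\<pi>: "J \<pi> = m"
    by (rule LIMSEQ_unique[OF J_lim m_eq]) (use \<pi>_range K_range[OF GK] G_lim in auto)
  have "(\<integral>p. ?d (k p) (\<pi> p) \<partial>M) + J \<pi> \<le> J k" if k: "k \<in> K" for k
  proof -
    note [measurable] = K_meas[OF k]
    define s where "s n = (\<lambda>p. (1 - 1 / real (Suc n)) * \<pi> p + 1 / real (Suc n) * k p)" for n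
    have s_meas [measurable]: "s n \<in> borel_measurable M" for n unfolding s_def by measurable
    have convex: "(1 - t) * x + t * y \<in> {0..1}"
      if "x \<in> {0..1}" "y \<in> {0..1}" "0 \<le> t" "t \<le> 1" for x y t :: real
      using convexD_alt[of "{0..1}" x y t] that by (simp only: real_scaleR_def) auto
    have s_range: "s n p \<in> {0..1}" if "p \<in> space M" for n p
      unfolding s_def by (intro convex \<pi>_range K_range[OF k] that) auto
    have s_lim: "(\<lambda>n. s n p) \<longlonglongrightarrow> \<pi> p" for p
    proof -
      have "(\<lambda>n. 1 / real (Suc n)) \<longlonglongrightarrow> 0"
        using LIMSEQ_inverse_real_of_nat by (simp add: inverse_eq_divide)
      then have "(\<lambda>n. s n p) \<longlonglongrightarrow> (1 - 0) * \<pi> p + 0 * k p"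
        unfolding s_def by (intro tendsto_intros)
      then show ?thesis by simp
    qed
    \<comment> \<open>\<open>\<pi>\<close> and \<open>s n\<close> need not lie in \<open>K\<close>.
      The bound \<open>m\<close> reaches \<open>s n\<close> through the mixtures \<open>h i\<close>
      of \<open>G i\<close> with \<open>k\<close>, which lie in \<open>K\<close> and converge to
      \<open>s n\<close> almost everywhere.\<close>
    have m_s: "m \<le> J (s n)" for n
    proof -
      define t where "t = 1 / real (Suc n)"
      have t: "0 \<le> t" "t \<le> 1" by (auto simp: t_def)
      define h where "h i = (\<lambda>p. (1 - t) * G i p + t * k p)" for i
      have hK: "h i \<in> K" for i unfolding h_def by (intro K_convex GK k t)
      have "(\<lambda>i. J (h i)) \<longlonglongrightarrow> J (s n)"
      proof (rule J_lim)
        show "AE p in M. (\<lambda>i. h i p) \<longlonglongrightarrow> s n p"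
          using G_lim
        proof eventually_elim
          case (elim p)
          then show ?case unfolding h_def s_def t_def[symmetric] by (intro tendsto_intros)
        qed
      qed (use K_meas[OF hK] K_range[OF hK] s_range in auto)
      then show ?thesis
        using m_le[OF hK] by (intro LIMSEQ_le_const) auto
    qed
    define S :: "(real \<times> real \<times> real \<times> real) set"
      where "S = {0..1} \<times> {0..1} \<times> {0..1} \<times> {0..1}"
    have S: "compact S" unfolding S_def by (intro compact_Times) auto
    \<comment> \<open>With \<open>x\<close> and \<open>w\<close> both equal to
      \<open>\<pi> p\<close>, this is the integrand of the directional derivative of
      \<open>J\<close> at \<open>\<pi>\<close> towards \<open>k\<close>. Keeping \<open>x\<close>
      separate admits \<open>s n p\<close> there, so bounds and a limit replace differentiation
      under the integral.\<close>
    define H where "H = (\<lambda>(x, y, z, w). (\<phi>' x - \<phi>' y) * (z - w))"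
    have H_cont: "continuous_on S H"
      unfolding H_def case_prod_beta
      by (intro continuous_intros cont) (auto simp: S_def)
    have "(\<lambda>n. \<integral>p. H (s n p, c p, k p, \<pi> p) \<partial>M) \<longlonglongrightarrow> (\<integral>p. H (\<pi> p, c p, k p, \<pi> p) \<partial>M)"
      by (rule integral_compose_continuous_on_tendsto[OF _ _ _ _ _ S H_cont])
        (use s_range c_range K_range[OF k] \<pi>_range s_lim in
          \<open>auto simp: S_def intro!: tendsto_intros\<close>)
    moreover have "(\<integral>p. H (s n p, c p, k p, \<pi> p) \<partial>M) \<ge> 0" for n
    proof -
      let ?t = "1 / real (Suc n)"
      note ints = d_int[OF s_meas s_range c_meas c_range, of n]
        d_int[OF \<pi>_meas \<pi>_range c_meas c_range]
      have intH: "integrable M (\<lambda>p. H (s n p, c p, k p, \<pi> p))"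
        by (rule integrable_compose_continuous_on[OF _ _ S H_cont])
          (use s_range c_range K_range[OF k] \<pi>_range in \<open>auto simp: S_def\<close>)
      have "0 \<le> J (s n) - J \<pi>" using m_s J_\<pi> by simp
      also have "\<dots> = (\<integral>p. ?d (s n p) (c p) - ?d (\<pi> p) (c p) \<partial>M)"
        using ints by (simp add: J_def)
      also have "\<dots> \<le> (\<integral>p. ?t * H (s n p, c p, k p, \<pi> p) \<partial>M)"
      proof (rule integral_mono)
        fix p assume p: "p \<in> space M"
        \<comment> \<open>This bounds the increment of \<open>\<phi>\<close> from
          \<open>\<pi> p\<close> to \<open>s n p\<close> by the slope at the far end
          \<open>s n p\<close>.\<close>
        have "?d (\<pi> p) (s n p) \<ge> 0"
          using bregman_nonneg[OF gen] \<pi>_range[of p] s_range[OF p, of n] by auto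
        moreover have "s n p - \<pi> p = ?t * (k p - \<pi> p)" by (simp add: s_def algebra_simps diff_divide_distrib)
        then have "?t * H (s n p, c p, k p, \<pi> p) = (\<phi>' (s n p) - \<phi>' (c p)) * (s n p - \<pi> p)"
          by (simp add: H_def)
        ultimately show "?d (s n p) (c p) - ?d (\<pi> p) (c p) \<le> ?t * H (s n p, c p, k p, \<pi> p)"
          by (simp add: bregman_def algebra_simps)
      qed (use ints intH in auto)
      also have "\<dots> = ?t * (\<integral>p. H (s n p, c p, k p, \<pi> p) \<partial>M)" using intH by simp
      finally show ?thesis by (simp add: zero_le_divide_iff)
    qed
    ultimately have "0 \<le> (\<integral>p. H (\<pi> p, c p, k p, \<pi> p) \<partial>M)"
      by (intro LIMSEQ_le_const) auto
    \<comment> \<open>The three-point identity for Bregman divergences.\<close>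
    also have "\<dots> = (\<integral>p. ?d (k p) (c p) - ?d (k p) (\<pi> p) - ?d (\<pi> p) (c p) \<partial>M)"
      by (simp add: H_def bregman_def algebra_simps)
    also have "\<dots> = J k - (\<integral>p. ?d (k p) (\<pi> p) \<partial>M) - J \<pi>"
      using d_int[OF K_meas[OF k] K_range[OF k] c_meas c_range]
        d_int[OF K_meas[OF k] K_range[OF k] \<pi>_meas \<pi>_range]
        d_int[OF \<pi>_meas \<pi>_range c_meas c_range]
      by (simp add: J_def)
    finally show ?thesis by simp
  qed
  then show ?thesis
    using that[of G \<pi>] GK \<pi>_meas \<pi>_range G_lim by (auto simp: J_def)
qed

end

subsection \<open>Finitely additive probabilities\<close>

lemma finitely_additive_probability_Pow_le_1:
  assumes "finitely_additive_probability W (Pow W) P" "p \<subseteq> W"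
  shows "P p \<le> 1"
proof -
  have "P (p \<union> (W - p)) = P p + P (W - p)"
    using assms unfolding finitely_additive_probability_def additive_def
    by (metis Diff_disjoint Diff_subset PowI)
  moreover have "p \<union> (W - p) = W" using assms(2) by auto
  moreover have "P (W - p) \<ge> 0" "P W = 1"
    using assms unfolding finitely_additive_probability_def by auto
  ultimately show ?thesis by simp
qed

lemma finitely_additive_probability_valuation:
  assumes "w \<in> W"
  shows "finitely_additive_probability W (Pow W) (valuation w)"
  using assms unfolding finitely_additive_probability_def additive_def valuation_def
  by (auto simp: algebra_Pow)

lemma finitely_additive_probability_mixture:
  assumes "finitely_additive_probability W A P" "finitely_additive_probability W A Q"
    and "0 \<le> t" "t \<le> 1"
  shows "finitely_additive_probability W A (\<lambda>p. (1 - t) * P p + t * Q p)"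
  unfolding finitely_additive_probability_def
proof (intro conjI ballI)
  fix p assume "p \<in> A"
  with assms show "0 \<le> (1 - t) * P p + t * Q p"
    by (auto simp: finitely_additive_probability_def intro!: add_nonneg_nonneg mult_nonneg_nonneg)
qed (use assms in \<open>auto simp: finitely_additive_probability_def additive_def algebra_simps\<close>)

lemma coherent_if_finitely_additive_probability_Pow:
  assumes "finitely_additive_probability W (Pow W) P" "F \<subseteq> Pow W"
  shows "coherent W F P"
  unfolding coherent_def credence_function_def
proof (intro conjI ballI exI[of _ "Pow W"] exI[of _ P])
  fix p assume "p \<in> F"
  with assms show "P p \<le> 1" by (intro finitely_additive_probability_Pow_le_1) auto
qed (use assms in \<open>auto simp: finitely_additive_probability_def\<close>)

text \<open>By Tychonoff's theorem the sequence has a cluster point in the cube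
  \<open>[0,1]\<^bsup>Pow W\<^esup>\<close>; each clause of finite additivity involves only
  finitely many coordinates and so passes to it.\<close>

lemma finitely_additive_probability_cluster_point:
  fixes P :: "nat \<Rightarrow> 'w set \<Rightarrow> real"
  assumes P: "\<And>n. finitely_additive_probability W (Pow W) (P n)"
  obtains Q where "finitely_additive_probability W (Pow W) Q"
    "\<And>p l. p \<subseteq> W \<Longrightarrow> (\<lambda>n. P n p) \<longlonglongrightarrow> l \<Longrightarrow> Q p = l"
proof -
  \<comment> \<open>The value 0 outside \<open>Pow W\<close> places the total functions in a cube
    over all sets.\<close>
  define R where "R n p = (if p \<subseteq> W then P n p else 0)" for n p
  define U :: "('w set \<Rightarrow> real) set" where "U = PiE UNIV (\<lambda>_. {0..1})"
  have "compactin (product_topology (\<lambda>_. euclidean) UNIV) U"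
    unfolding U_def compactin_PiE by auto
  then have "compact U" by (simp add: euclidean_product_topology)
  moreover have "filtermap R sequentially \<noteq> bot" by (simp add: filtermap_bot_iff)
  moreover have "\<forall>\<^sub>F f in filtermap R sequentially. f \<in> U"
    unfolding eventually_filtermap
  proof (rule always_eventually, rule allI)
    show "R n \<in> U" for n
      using P[of n] finitely_additive_probability_Pow_le_1[OF P]
      by (auto simp: U_def R_def finitely_additive_probability_def)
  qed
  ultimately obtain Q where "inf (nhds Q) (filtermap R sequentially) \<noteq> bot"
    unfolding compact_filter by blast
  \<comment> \<open>\<open>L\<close> plays the role of a convergent subnet, since in an uncountable
    product no subsequence need converge. Coordinates tend to those of \<open>Q\<close> along
    \<open>L\<close>, and whatever holds for every \<open>R n\<close> holds eventually.\<close>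
  define L where "L = inf (nhds Q) (filtermap R sequentially)"
  have "L \<noteq> bot" unfolding L_def by fact
  have coord: "((\<lambda>f. f p) \<longlongrightarrow> Q p) L" for p
  proof -
    have "continuous_on UNIV (\<lambda>f. f p :: real)" by simp
    then have "((\<lambda>f. f p) \<longlongrightarrow> Q p) (at Q)" by (simp add: continuous_on_def)
    then have "((\<lambda>f. f p) \<longlongrightarrow> Q p) (nhds Q)" using tendsto_at_iff_tendsto_nhds[of "\<lambda>f. f p" Q] by simp
    then show ?thesis by (rule tendsto_mono[rotated]) (simp add: L_def)
  qed
  have ev: "\<forall>\<^sub>F f in L. X f" if "\<And>n. X (R n)" for X
    by (rule filter_leD[of L "filtermap R sequentially"]) (auto simp: L_def eventually_filtermap that)
  note unique = tendsto_unique[OF \<open>L \<noteq> bot\<close>]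
  have "Q p \<ge> 0" if "p \<subseteq> W" for p
    by (rule tendsto_lowerbound[OF coord ev \<open>L \<noteq> bot\<close>])
      (use P that in \<open>auto simp: R_def finitely_additive_probability_def\<close>)
  moreover have "Q W = 1"
    by (rule unique[OF coord tendsto_eventually[OF ev]])
      (use P in \<open>simp add: R_def finitely_additive_probability_def\<close>)
  moreover have "Q (x \<union> y) = Q x + Q y" if "x \<subseteq> W" "y \<subseteq> W" "x \<inter> y = {}" for x y
  proof (rule unique[OF coord])
    have "\<forall>\<^sub>F f in L. f x + f y = f (x \<union> y)"
      by (rule ev) (use P that in \<open>auto simp: R_def finitely_additive_probability_def additive_def\<close>)
    moreover have "((\<lambda>f. f x + f y) \<longlongrightarrow> Q x + Q y) L" by (intro tendsto_intros coord)
    ultimately show "((\<lambda>f. f (x \<union> y)) \<longlongrightarrow> Q x + Q y) L" using tendsto_cong by fastforce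
  qed
  ultimately have "finitely_additive_probability W (Pow W) Q"
    by (auto simp: finitely_additive_probability_def additive_def algebra_Pow)
  moreover have "Q p = l" if "p \<subseteq> W" "(\<lambda>n. P n p) \<longlonglongrightarrow> l" for p l
  proof (rule unique[OF coord])
    have "((\<lambda>f. f p) \<longlongrightarrow> l) (filtermap R sequentially)"
      using that by (simp add: filterlim_filtermap R_def)
    then show "((\<lambda>f. f p) \<longlongrightarrow> l) L" by (rule tendsto_mono[rotated]) (simp add: L_def)
  qed
  ultimately show ?thesis using that by blast
qed

subsection \<open>Dominance\<close>

theorem theorem5p3:
  fixes W :: "'w set" and F :: "'w set set" and M :: "'w set measure"
    and I :: "('w set \<Rightarrow> real) \<Rightarrow> 'w \<Rightarrow> ennreal"
  assumes "W \<noteq> {}"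
    and "F \<subseteq> Pow W"
    and "space M = F"
    and "finite_measure M"
    and "integral_inaccuracy_measure W M I"
  shows "\<forall>c. mu_credence_function M c \<and> mu_incoherent W M c \<longrightarrow>
           (\<exists>c'. mu_credence_function M c' \<and> mu_coherent W M c' \<and> strongly_dominates W I c' c)"
proof (intro allI impI)
  fix c assume "mu_credence_function M c \<and> mu_incoherent W M c"
  then have c: "mu_credence_function M c" "mu_incoherent W M c" by auto
  interpret finite_measure M by fact
  have space: "p \<subseteq> W" if "p \<in> space M" for p using assms(2,3) that by auto
  obtain \<phi> \<phi>' where gen: "bregman_generator \<phi> \<phi>'"
    and I: "\<And>b w. mu_credence_function M b \<Longrightarrow> w \<in> W \<Longrightarrow>
      I b w = integral_bregman \<phi> \<phi>' M (valuation w) b"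
    and val: "\<And>w. w \<in> W \<Longrightarrow> valuation w \<in> borel_measurable M"
    using assms(5) unfolding integral_inaccuracy_measure_def
    by (auto simp: mu_credence_function_def)
  let ?d = "bregman \<phi> \<phi>'"
  note [measurable] = val
  have [measurable]: "c \<in> borel_measurable M"
    and c_nonneg: "\<And>p. p \<in> space M \<Longrightarrow> 0 \<le> c p"
    using c(1) by (auto simp: mu_credence_function_def)
  \<comment> \<open>\<open>c\<close> may exceed 1 on a null set; truncation gives the range needed
    for projecting and preserves all inaccuracies.\<close>
  define b where "b p = min 1 (c p)" for p
  have [measurable]: "b \<in> borel_measurable M" unfolding b_def by measurable
  have b_range: "b p \<in> {0..1}" if "p \<in> space M" for p
    using c_nonneg[OF that] by (simp add: b_def)
  have "AE p in M. c p \<in> {0..1}"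
    using c(1) by (subst AE_iff_measurable[OF _ refl]) (auto simp: mu_credence_function_def)
  then have cb: "AE p in M. c p = b p" by eventually_elim (simp add: b_def)

  \<comment> \<open>All members live on the single algebra \<open>Pow W\<close>, so mixtures and
    cluster points stay among functions with the same domain.\<close>
  define K where "K = {P. P \<in> borel_measurable M \<and> finitely_additive_probability W (Pow W) P}"
  have K_val: "valuation w \<in> K" if "w \<in> W" for w
    using that val finitely_additive_probability_valuation by (auto simp: K_def)
  have K_range: "P p \<in> {0..1}" if "P \<in> K" "p \<in> space M" for P p
    using that finitely_additive_probability_Pow_le_1[of W P p] space
    by (auto simp: K_def finitely_additive_probability_def)
  obtain g \<pi> where gK: "\<And>n::nat. g n \<in> K" and \<pi> [measurable]: "\<pi> \<in> borel_measurable M"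
    and \<pi>_range: "\<And>p. \<pi> p \<in> {0..1}" and g_lim: "AE p in M. (\<lambda>n. g n p) \<longlonglongrightarrow> \<pi> p"
    and pythagoras: "\<And>k. k \<in> K \<Longrightarrow>
      (\<integral>p. ?d (k p) (\<pi> p) \<partial>M) + (\<integral>p. ?d (\<pi> p) (b p) \<partial>M) \<le> (\<integral>p. ?d (k p) (b p) \<partial>M)"
  proof (rule bregman_projection[OF gen, of K b])
    show "K \<noteq> {}" using assms(1) K_val by blast
  qed (use K_range b_range finitely_additive_probability_mixture in
      \<open>auto simp: K_def intro!: borel_measurable_add borel_measurable_times\<close>)

  \<comment> \<open>\<open>Q\<close> is not claimed to be measurable: it only witnesses coherence of
    the measurable \<open>\<pi>\<close>.\<close>
  obtain Q where Q: "finitely_additive_probability W (Pow W) Q"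
    "\<And>p l. p \<subseteq> W \<Longrightarrow> (\<lambda>n. g n p) \<longlonglongrightarrow> l \<Longrightarrow> Q p = l"
    using finitely_additive_probability_cluster_point[of W g] gK by (auto simp: K_def)
  have "AE p in M. \<pi> p = Q p"
    using g_lim AE_space by eventually_elim (use Q(2) space in auto)
  then have \<pi>_coherent: "mu_coherent W M \<pi>"
    unfolding mu_coherent_def
    using coherent_if_finitely_additive_probability_Pow[OF Q(1)] assms(2,3) by blast
  have \<pi>_credence: "mu_credence_function M \<pi>"
    using \<pi>_range unfolding mu_credence_function_def by auto

  have int: "integrable M (\<lambda>p. ?d (f p) (h p))"
    if "f \<in> borel_measurable M" "\<And>p. p \<in> space M \<Longrightarrow> f p \<in> {0..1}"
      "h \<in> borel_measurable M" "\<And>p. p \<in> space M \<Longrightarrow> h p \<in> {0..1}" for f h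
    using that by (rule integrable_bregman[OF gen])
  \<comment> \<open>Otherwise \<open>\<pi>\<close>, \<open>b\<close> and \<open>c\<close> agree
    almost everywhere, and \<open>c\<close> inherits the coherent witness of
    \<open>\<pi>\<close>.\<close>
  have \<pi>b_pos: "0 < (\<integral>p. ?d (\<pi> p) (b p) \<partial>M)"
  proof (rule ccontr)
    have nonneg: "AE p in M. ?d (\<pi> p) (b p) \<ge> 0"
      using bregman_nonneg[OF gen] \<pi>_range b_range by (intro AE_I2) auto
    assume "\<not> ?thesis"
    then have "(\<integral>p. ?d (\<pi> p) (b p) \<partial>M) = 0"
      using integral_nonneg_AE[OF nonneg] by simp
    then have "AE p in M. ?d (\<pi> p) (b p) = 0"
      using integral_nonneg_eq_0_iff_AE[OF int nonneg] \<pi>_range b_range by simp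
    with cb AE_space have "AE p in M. \<pi> p = c p"
    proof eventually_elim
      case (elim p)
      then show ?case
        using bregman_pos[OF gen, of "\<pi> p" "b p"] \<pi>_range[of p] b_range[of p] by fastforce
    qed
    moreover obtain f where "coherent W (space M) f" "AE p in M. \<pi> p = f p"
      using \<pi>_coherent unfolding mu_coherent_def by blast
    ultimately have "AE p in M. c p = f p" by (auto elim: eventually_elim2)
    with \<open>coherent W (space M) f\<close> c(2) show False unfolding mu_coherent_def by blast
  qed

  have "I \<pi> w < I c w" if w: "w \<in> W" for w
  proof -
    let ?v = "valuation w"
    have v_range: "?v p \<in> {0..1}" for p by (simp add: valuation_def)
    \<comment> \<open>Passing to finite real integrals is what lets the positive term in
      \<open>pythagoras\<close> give a strict inequality.\<close>
    have eq: "(\<integral>\<^sup>+p. ennreal (?d (?v p) (h p)) \<partial>M) = ennreal (\<integral>p. ?d (?v p) (h p) \<partial>M)"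
      if "h \<in> borel_measurable M" "\<And>p. p \<in> space M \<Longrightarrow> h p \<in> {0..1}" for h
      using that v_range val[OF w] bregman_nonneg[OF gen]
      by (intro nn_integral_eq_integral int AE_I2) auto
    have "I \<pi> w = ennreal (\<integral>p. ?d (?v p) (\<pi> p) \<partial>M)"
      using I[OF \<pi>_credence w] eq[OF \<pi>] \<pi>_range by (simp add: integral_bregman_def)
    also have "\<dots> < ennreal (\<integral>p. ?d (?v p) (b p) \<partial>M)"
    proof (rule ennreal_lessI)
      have "0 \<le> (\<integral>p. ?d (?v p) (\<pi> p) \<partial>M)"
        using bregman_nonneg[OF gen] \<pi>_range v_range by (intro integral_nonneg_AE AE_I2) auto
      then show "0 < (\<integral>p. ?d (?v p) (b p) \<partial>M)"
        "(\<integral>p. ?d (?v p) (\<pi> p) \<partial>M) < (\<integral>p. ?d (?v p) (b p) \<partial>M)"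
        using pythagoras[OF K_val[OF w]] \<pi>b_pos by auto
    qed
    also have "\<dots> = (\<integral>\<^sup>+p. ennreal (?d (?v p) (b p)) \<partial>M)"
      using b_range by (subst eq) auto
    also have "\<dots> = (\<integral>\<^sup>+p. ennreal (?d (?v p) (c p)) \<partial>M)"
      using cb by (intro nn_integral_cong_AE) (auto elim: eventually_mono)
    also have "\<dots> = I c w" using I[OF c(1) w] by (simp add: integral_bregman_def)
    finally show ?thesis .
  qed
  then show "\<exists>c'. mu_credence_function M c' \<and> mu_coherent W M c' \<and> strongly_dominates W I c' c"
    using \<pi>_credence \<pi>_coherent unfolding strongly_dominates_def by blast
qed

end
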